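(* The generating function of the twisted Hurwitz numbers $$\mathcal H^{\sim}(\beta,p)=\sum_{m\ge 0}\sum_\lambda \frac{h_{m,\lambda}^{\sim}}{m!}\,p_{\lambda_1}p_{\lambda_2}\cdots p_{\lambda_s}\,\beta^m$$ (the inner sum is over all partitions $\lambda=(\lambda_1\ge\dots\ge\lambda_s)$) satisfies the cut-and-join equation $$\frac{\partial\mathcal H^{\sim}}{\partial\beta}=\mathcal{CJ}^{\sim}(\mathcal H^{\sim}),$$ where $\mathcal{CJ}^{\sim}$ is the twisted cut-and-join operator.
   Context: Twisted Hurwitz numbers. A decorated-boundary surface (DBS) with $n$ marked points is a triple $(M,(a_1,\dots,a_n),(o_1,\dots,o_n))$, $M$ a compact surface (not necessarily connected or orientable) with boundary, $a_i\in\partial M$ marked points, $o_i$ a local orientation of $\partial M$ near $a_i$, every component of $M$ having nonempty boundary and every component of $\partial M$ containing some $a_i$; DBS are considered up to homeomorphisms preserving the marked points with their numbers and the $o_i$. $E_n$ is the union of $n$ disks with one marked point on the boundary of each. The ribbon gluing $G[i,j]^{\varepsilon,\delta}$ ($i\ne j$; $\varepsilon,\delta\in\{+,-\}$) attaches a narrow rectangle by its short sides to boundary segments $a_ia_i'$, $a_ja_j'$, where $a_ia_i'$ is directed along $o_i$ if $\varepsilon=+$ and opposite if $\varepsilon=-$ (same for $j,\delta$), so that $a_i,a_j$ are opposite corners of it; local orientations are kept on the remaining old boundary near $a_i,a_j$. A ribbon decomposition into $m$ ribbons is a sequence of $m$ gluings applied to $E_n$ (with $G[i,j]^{\varepsilon,\delta}$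 and $G[j,i]^{\delta,\varepsilon}$ the same). For a partition $\lambda$ of $n$, $\mathfrak S_{m,\lambda}$ is the set of ribbon decompositions into $m$ ribbons of surfaces whose boundary has $s$ components containing $\lambda_1,\dots,\lambda_s$ marked points, and $h_{m,\lambda}^{\sim}=\frac1{n!}\#\mathfrak S_{m,\lambda}$. Equivalently, $h^{\sim}_{m,\lambda}=\frac1{n!}\#\mathfrak H_{m,\lambda}$, where $\mathfrak H_{m,\lambda}$ is the set of sequences $(\sigma_1,\dots,\sigma_m)$ of transpositions $\sigma_k=(i_k\,j_k)\in S_{2n}$, $j_k\neq\tau(i_k)$, with $\sigma_1\cdots\sigma_m(\tau\sigma_m\tau)\cdots(\tau\sigma_1\tau)\in B_\lambda^{\sim}$, in the notation below. Algebra. $\tau=(1,n+1)(2,n+2)\cdots(n,2n)\in S_{2n}$; $B_n=C(\tau)$ is its centralizer in $S_{2n}$. $B_\lambda^{\sim}$ is the set of $\sigma\in S_{2n}$ with $\tau\sigma\tau=\sigma^{-1}$ whose decomposition into independent cycles (fixed points included) consists of $s$ pairs of $\tau$-symmetric cycles of lengths $\lambda_1,\dots,\lambda_s$ (distinct cycles $(u_1\dots u_k)$ and $(\tau(u_k)\dots\tau(u_1))$ are called $\tau$-symmetric); $B_n^{\sim}=\bigsqcup_{|\lambda|=n}B_\lambda^{\sim}$. $\mathbb C[B_n^{\sim}]$ is the vector space with basis $B_n^{\sim}$, and $\mathcal Z(B_n^{\sim})=\{y\in\mathbb C[B_n^{\sim}]\mid xyx^{-1}=y\ \forall x\in B_n\}$;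 it has as a basis the conjugacy class sums $\mathcal C_\lambda^{\sim}=\sum_{\sigma\in B_\lambda^{\sim}}\sigma$, $|\lambda|=n$. Let $\mathbb C[p]$ be the polynomials in $p_1,p_2,\dots$ with $\deg p_k=k$, and $\mathbb C[p]_n$ the homogeneous polynomials of degree $n$. $\Psi:\mathcal Z(B_n^{\sim})\to\mathbb C[p]_n$ is the linear isomorphism with $\Psi(\mathcal C_\lambda^{\sim})=p_\lambda=p_{\lambda_1}\cdots p_{\lambda_s}$. The operator $\mathfrak{CJ}^{\sim}:\mathcal Z(B_n^{\sim})\to\mathcal Z(B_n^{\sim})$ is defined by $$\mathfrak{CJ}^{\sim}(\sigma)=\sum_{1\le i<j\le 2n,\ j\ne\tau(i)}(i\,j)\,\sigma\,(\tau(i)\,\tau(j)),\qquad \sigma\in B_n^{\sim}$$ (extended linearly). The twisted cut-and-join operator $\mathcal{CJ}^{\sim}:\mathbb C[p]_n\to\mathbb C[p]_n$ is the linear map with $\mathcal{CJ}^{\sim}\circ\Psi=\Psi\circ\mathfrak{CJ}^{\sim}$; it is defined for all $n$ and extended to power series degree by degree. For the empty partition $h^{\sim}_{0,\emptyset}=1$ and $h^{\sim}_{m,\emptyset}=0$ for $m>0$.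
   Formalization: Ψ is normalised by Ψ(C_λ) = |B_λ~|·p_λ instead of Ψ(C_λ) = p_λ; with the latter the equation fails already in degree 2, where it would give 2p_2 = p_2 at β^0. *)

theory Defs
  imports Complex_Main
    "HOL-Library.Multiset"
    "HOL-Library.Poly_Mapping"
    "HOL-Combinatorics.Combinatorics"
    "HOL-Computational_Algebra.Formal_Power_Series"
begin

text \<open>Permutations of \<open>{1..2n}\<close> are functions with \<open>permutes {1..2 * n}\<close>; products are
  compositions.\<close>

definition partitions :: "nat \<Rightarrow> nat multiset set" where
  "partitions n = {\<mu>. 0 \<notin># \<mu> \<and> sum_mset \<mu> = n}"

definition tau :: "nat \<Rightarrow> nat \<Rightarrow> nat" where
  "tau n i = (if i \<in> {1..n} then i + n else if i \<in> {n+1..2*n} then i - n else i)"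

definition hyperoct :: "nat \<Rightarrow> (nat \<Rightarrow> nat) set" where
  "hyperoct n = {x. x permutes {1..2*n} \<and> x \<circ> tau n = tau n \<circ> x}"

definition comp_list :: "('a \<Rightarrow> 'a) list \<Rightarrow> 'a \<Rightarrow> 'a" where
  "comp_list fs = foldr (\<circ>) fs id"

definition tau_cycle :: "nat \<Rightarrow> nat list \<Rightarrow> nat list" where
  "tau_cycle n c = rev (map (tau n) c)"

text \<open>The list \<open>cs\<close> contains one cycle from each pair of \<open>\<tau>\<close>-symmetric cycles, fixed points
  being cycles of length one. Distinctness of the concatenation says that every listed cycle has
  distinct entries and that all cycles, including the two in each pair, are disjoint.\<close>

definition B_type :: "nat \<Rightarrow> nat multiset \<Rightarrow> (nat \<Rightarrow> nat) set" where
  "B_type n \<mu> = {\<sigma>. \<sigma> permutes {1..2*n} \<and> tau n \<circ> \<sigma> \<circ> tau n = inv \<sigma> \<and>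
     (\<exists>cs. mset (map length cs) = \<mu> \<and>
        distinct (concat (cs @ map (tau_cycle n) cs)) \<and>
        set (concat (cs @ map (tau_cycle n) cs)) = {1..2*n} \<and>
        \<sigma> = comp_list (map cycle_of_list (cs @ map (tau_cycle n) cs)))}"

definition B_twisted :: "nat \<Rightarrow> (nat \<Rightarrow> nat) set" where
  "B_twisted n = (\<Union>\<mu>\<in>partitions n. B_type n \<mu>)"

definition admissible_transpositions :: "nat \<Rightarrow> (nat \<Rightarrow> nat) set" where
  "admissible_transpositions n =
     {transpose i j | i j. i \<in> {1..2*n} \<and> j \<in> {1..2*n} \<and> i \<noteq> j \<and> j \<noteq> tau n i}"

definition hurwitz_sequences :: "nat \<Rightarrow> nat multiset \<Rightarrow> (nat \<Rightarrow> nat) list set" where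
  "hurwitz_sequences m \<mu> = (let n = sum_mset \<mu> in
     {ss. length ss = m \<and> set ss \<subseteq> admissible_transpositions n \<and>
          comp_list (ss @ rev (map (\<lambda>s. tau n \<circ> s \<circ> tau n) ss)) \<in> B_type n \<mu>})"

definition twisted_hurwitz :: "nat \<Rightarrow> nat multiset \<Rightarrow> complex" where
  "twisted_hurwitz m \<mu> = of_nat (card (hurwitz_sequences m \<mu>)) / fact (sum_mset \<mu>)"

text \<open>Formal complex linear combinations of permutations, and polynomials in
  \<open>p\<^sub>1, p\<^sub>2, \<dots>\<close> (monomials are exponent maps; index 0 is never used).\<close>

type_synonym perm_comb = "(nat \<Rightarrow> nat) \<Rightarrow>\<^sub>0 complex"
type_synonym cpoly = "(nat \<Rightarrow>\<^sub>0 nat) \<Rightarrow>\<^sub>0 complex"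

definition cscale :: "complex \<Rightarrow> ('a \<Rightarrow>\<^sub>0 complex) \<Rightarrow> ('a \<Rightarrow>\<^sub>0 complex)" where
  "cscale c f = Poly_Mapping.map ((*) c) f"

definition pvar :: "nat \<Rightarrow> cpoly" where
  "pvar k = Poly_Mapping.single (Poly_Mapping.single k 1) 1"

definition p_part :: "nat multiset \<Rightarrow> cpoly" where
  "p_part \<mu> = prod_mset (image_mset pvar \<mu>)"

definition conj_comb :: "(nat \<Rightarrow> nat) \<Rightarrow> perm_comb \<Rightarrow> perm_comb" where
  "conj_comb x y =
     (\<Sum>\<sigma>\<in>Poly_Mapping.keys y. Poly_Mapping.single (x \<circ> \<sigma> \<circ> inv x) (Poly_Mapping.lookup y \<sigma>))"

definition Z_twisted :: "nat \<Rightarrow> perm_comb set" where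
  "Z_twisted n = {y. Poly_Mapping.keys y \<subseteq> B_twisted n \<and> (\<forall>x\<in>hyperoct n. conj_comb x y = y)}"

definition class_sum :: "nat \<Rightarrow> nat multiset \<Rightarrow> perm_comb" where
  "class_sum n \<mu> = (\<Sum>\<sigma>\<in>B_type n \<mu>. Poly_Mapping.single \<sigma> 1)"

text \<open>The linear map on \<open>Z_twisted n\<close> with \<open>class_sum n \<mu> \<mapsto> card (B_type n \<mu>) \<cdot> p_part \<mu>\<close>;
  equivalently, the normalised class sum goes to \<open>p_part \<mu>\<close>, and each single permutation in
  \<open>B_type n \<mu>\<close> contributes \<open>p_part \<mu>\<close>. The factor \<open>card (B_type n \<mu>)\<close> cannot be dropped: if the
  unnormalised sum were sent to \<open>p_part \<mu>\<close>, the induced cut-and-join operator would be the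
  transpose (with respect to the basis \<open>p_part \<mu>\<close>) of the present one. Already in degree 2 it would
  give \<open>p\<^sub>1\<^sup>2 \<mapsto> 2 p\<^sub>2\<close>, whereas \<open>twisted_hurwitz 0 {#1, 1#} = 1/2\<close> and \<open>twisted_hurwitz 1 {#2#} = 2\<close>
  require
  \<open>p\<^sub>1\<^sup>2 \<mapsto> 4 p\<^sub>2\<close> in the cut-and-join equation.\<close>

definition Psi :: "nat \<Rightarrow> perm_comb \<Rightarrow> cpoly" where
  "Psi n y = (THE f. \<exists>c. y = (\<Sum>\<mu>\<in>partitions n. cscale (c \<mu>) (class_sum n \<mu>)) \<and>
     f = (\<Sum>\<mu>\<in>partitions n. cscale (c \<mu> * of_nat (card (B_type n \<mu>))) (p_part \<mu>)))"

definition cut_join_alg :: "nat \<Rightarrow> perm_comb \<Rightarrow> perm_comb" where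
  "cut_join_alg n y = (\<Sum>\<sigma>\<in>Poly_Mapping.keys y.
     \<Sum>(i, j)\<in>{(i, j). 1 \<le> i \<and> i < j \<and> j \<le> 2*n \<and> j \<noteq> tau n i}.
       Poly_Mapping.single (transpose i j \<circ> \<sigma> \<circ> transpose (tau n i) (tau n j))
         (Poly_Mapping.lookup y \<sigma>))"

text \<open>Meaningful on polynomials homogeneous of degree \<open>n\<close> (with \<open>deg p\<^sub>k = k\<close>), onto which
  \<open>Psi n\<close> maps \<open>Z_twisted n\<close> bijectively.\<close>

definition cut_join :: "nat \<Rightarrow> cpoly \<Rightarrow> cpoly" where
  "cut_join n f = Psi n (cut_join_alg n (inv_into (Z_twisted n) (Psi n) f))"

text \<open>A formal power series in \<open>\<beta>, p\<^sub>1, p\<^sub>2, \<dots>\<close> is given by the family of its homogeneous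
  components in \<open>p\<close>: the component of degree \<open>n\<close> is a power series in \<open>\<beta>\<close> whose coefficients are
  homogeneous polynomials of degree \<open>n\<close> in the \<open>p\<^sub>k\<close>.\<close>

type_synonym pbeta_series = "nat \<Rightarrow> cpoly fps"

definition series_deriv_beta :: "pbeta_series \<Rightarrow> pbeta_series" where
  "series_deriv_beta F = (\<lambda>n. fps_deriv (F n))"

definition series_cut_join :: "pbeta_series \<Rightarrow> pbeta_series" where
  "series_cut_join F = (\<lambda>n. Abs_fps (\<lambda>m. cut_join n (fps_nth (F n) m)))"

definition twisted_hurwitz_series :: pbeta_series where
  "twisted_hurwitz_series = (\<lambda>n. Abs_fps (\<lambda>m.
     \<Sum>\<mu>\<in>partitions n. cscale (twisted_hurwitz m \<mu> / fact m) (p_part \<mu>)))"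

end

theory Submission
  imports Defs
begin

text \<open>
  Let \<open>Y\<^sub>m\<close> be the sum of the products \<open>\<sigma>\<^sub>1 \<cdots> \<sigma>\<^sub>m (\<tau> \<sigma>\<^sub>m \<tau>) \<cdots> (\<tau> \<sigma>\<^sub>1 \<tau>)\<close> over all sequences of
  admissible transpositions (\<open>sequence_sum\<close>). Putting one more transposition in front of a sequence
  multiplies the product by \<open>(i j)\<close> on the left and by \<open>(\<tau> i \<tau> j)\<close> on the right, hence the algebraic
  cut-and-join operator maps \<open>Y\<^sub>m\<close> to \<open>Y\<^sub>m\<^sub>+\<^sub>1\<close> (\<open>cut_join_alg_sequence_sum\<close>). Under \<open>Psi\<close> every
  permutation of type \<open>\<mu>\<close> contributes \<open>p_part \<mu>\<close>, so \<open>Psi n Y\<^sub>m\<close> collects the numbers of Hurwitz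
  sequences (\<open>Psi_sequence_sum\<close>), and the coefficient of \<open>\<beta>\<^sup>m\<close> in degree \<open>n\<close> of the generating
  function is \<open>Psi n Y\<^sub>m / (n! m!)\<close>. The derivative with respect to \<open>\<beta>\<close> replaces this by
  \<open>Psi n Y\<^sub>m\<^sub>+\<^sub>1 / (n! m!)\<close>, and so does the cut-and-join operator.

  What remains is to see that the cut-and-join operator on polynomials really is the algebraic one
  transported by \<open>Psi\<close>, that is, that \<open>Psi\<close> is well defined and injective on the invariant
  combinations and that \<open>Y\<^sub>m\<close> is one of them. Three facts about the sets \<open>B_type n \<mu>\<close> are behind
  this. They are disjoint for different partitions, since the type can be read off from the sizes of
  orbits (\<open>B_type_unique\<close>). The hyperoctahedral group acts transitively on each of them by conjugation
  (\<open>B_type_conjugate\<close>), so invariant combinations are combinations of class sums. And they contain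
  all the products above (\<open>twisted_prod_in_B_twisted\<close>): such a product has the form
  \<open>\<sigma> = a \<tau> a\<inverse> \<tau>\<close>, a product of two involutions without fixed points, and for these
  \<open>\<tau>\<close> can never map a cycle of \<open>\<sigma>\<close> to itself (\<open>tau_not_in_orbit\<close>), so the cycles come in pairs.
\<close>

section \<open>The involution and its centralizer\<close>

lemma tau_tau [simp]: "tau n (tau n i) = i"
  by (auto simp: tau_def)

lemma tau_mem_iff: "tau n i \<in> {1..2*n} \<longleftrightarrow> i \<in> {1..2*n}"
  by (auto simp: tau_def)

lemma tau_fixed_point_free: "i \<in> {1..2*n} \<Longrightarrow> tau n i \<noteq> i"
  by (auto simp: tau_def)

lemma tau_outside: "i \<notin> {1..2*n} \<Longrightarrow> tau n i = i"
  by (auto simp: tau_def)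

lemma tau_comp_tau [simp]: "tau n \<circ> tau n = id"
  by (simp add: fun_eq_iff)

lemma bij_tau: "bij (tau n)"
  by (rule o_bij[of "tau n"]) simp_all

lemma tau_eq_iff [simp]: "tau n i = tau n j \<longleftrightarrow> i = j"
  by (metis tau_tau)

lemma tau_permutes: "tau n permutes {1..2*n}"
  using tau_mem_iff[of n] tau_outside[of _ n] bij_tau[of n]
  by (auto simp: permutes_def bij_iff)

lemma comp_list_Nil [simp]: "comp_list [] = id"
  and comp_list_Cons [simp]: "comp_list (f # fs) = f \<circ> comp_list fs"
  by (simp_all add: comp_list_def)

lemma comp_list_append [simp]: "comp_list (fs @ gs) = comp_list fs \<circ> comp_list gs"
  by (induction fs) (simp_all add: comp_assoc)

lemma comp_list_conj:
  assumes "bij x"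
  shows "x \<circ> comp_list fs \<circ> inv x = comp_list (map (\<lambda>f. x \<circ> f \<circ> inv x) fs)"
proof (induction fs)
  case Nil
  show ?case using assms by (simp add: fun_eq_iff bij_is_surj surj_f_inv_f)
next
  case (Cons f fs)
  have "inv x (x y) = y" for y
    using assms by (simp add: bij_is_inj)
  then show ?case
    unfolding list.map comp_list_Cons Cons.IH[symmetric] by (simp add: fun_eq_iff)
qed

lemma hyperoct_apply_tau: "x \<in> hyperoct n \<Longrightarrow> x (tau n i) = tau n (x i)"
  by (auto simp: hyperoct_def fun_eq_iff)

lemma hyperoct_bij: "x \<in> hyperoct n \<Longrightarrow> bij x"
  by (auto simp: hyperoct_def permutes_bij)

lemma hyperoct_inv:
  assumes "x \<in> hyperoct n"
  shows "inv x \<in> hyperoct n"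
proof -
  have "inv x (tau n i) = tau n (inv x i)" for i
    by (rule sym, unfold bij_inv_eq_iff[OF hyperoct_bij[OF assms]] hyperoct_apply_tau[OF assms])
      (simp add: hyperoct_bij[OF assms] bij_is_surj surj_f_inv_f)
  then show ?thesis
    using assms by (auto simp: hyperoct_def permutes_inv fun_eq_iff)
qed

section \<open>Products of disjoint cycles\<close>

lemma disjoint_cycles_outside:
  "y \<notin> set (concat L) \<Longrightarrow> comp_list (map cycle_of_list L) y = y"
  by (induction L) (simp_all add: id_outside_supp)

lemma disjoint_cycles_apply:
  assumes "distinct (concat L)" "c \<in> set L" "y \<in> set c"
  shows "comp_list (map cycle_of_list L) y = cycle_of_list c y"
  using assms
proof (induction L)
  case (Cons d L)
  show ?case
  proof (cases "y \<in> set d")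
    case True
    with Cons.prems have *: "y \<notin> set (concat L)" by auto
    with Cons.prems have "c = d" by auto
    with * show ?thesis by (simp add: disjoint_cycles_outside)
  next
    case False
    with Cons.prems have c: "c \<in> set L" by auto
    have "cycle_of_list c y \<in> set c"
      using Cons.prems(3) permutes_in_image[OF cycle_permutes] by metis
    with Cons.prems c have "cycle_of_list c y \<notin> set d" by auto
    with Cons c show ?thesis by (simp add: id_outside_supp)
  qed
qed simp

lemma mset_concat_cong: "mset L = mset L' \<Longrightarrow> mset (concat L) = mset (concat L')"
  by (simp add: mset_concat flip: sum_mset_sum_list)

text \<open>Disjoint cycles commute: the value of the product at a point is decided by the only
  cycle through that point, wherever it stands in the list.\<close>

lemma disjoint_cycles_reorder:
  assumes "mset L = mset L'" "distinct (concat L)"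
  shows "comp_list (map cycle_of_list L) = comp_list (map cycle_of_list L')"
proof
  fix y
  have d: "distinct (concat L')"
    using assms mset_concat_cong mset_eq_imp_distinct_iff by blast
  have s: "set L = set L'"
    using assms(1) by (rule mset_eq_setD)
  show "comp_list (map cycle_of_list L) y = comp_list (map cycle_of_list L') y"
  proof (cases "\<exists>c\<in>set L. y \<in> set c")
    case True
    then show ?thesis
      using disjoint_cycles_apply[OF assms(2)] disjoint_cycles_apply[OF d] s by metis
  next
    case False
    with s show ?thesis by (simp add: disjoint_cycles_outside)
  qed
qed

text \<open>Along \<open>c\<close> the map \<open>\<sigma>\<close> moves every entry to the next one cyclically, so any entry runs
  through the whole list.\<close>

lemma cycle_orbit:
  assumes c: "distinct c" "y \<in> set c" and \<sigma>: "\<And>z. z \<in> set c \<Longrightarrow> \<sigma> z = cycle_of_list c z"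
  shows "range (\<lambda>k. (\<sigma> ^^ k) y) = set c"
proof -
  have in_c: "(cycle_of_list c ^^ k) y \<in> set c" for k
    using c(2) by (induction k) (simp_all add: permutes_in_image[OF cycle_permutes])
  have pow: "(\<sigma> ^^ k) y = (cycle_of_list c ^^ k) y" for k
    by (induction k) (simp_all add: \<sigma> in_c)
  obtain t where t: "t < length c" "y = c ! t"
    using c(2) by (auto simp: in_set_conv_nth)
  have nth: "(\<sigma> ^^ k) y = c ! ((k + t) mod length c)" for k
  proof -
    have "(\<sigma> ^^ k) y = map (cycle_of_list c ^^ k) c ! t"
      using t pow by simp
    also have "\<dots> = rotate k c ! t"
      by (simp only: cyclic_rotation[OF c(1)])
    finally show ?thesis
      using t by (simp add: nth_rotate)
  qed
  show ?thesis
  proof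
    show "range (\<lambda>k. (\<sigma> ^^ k) y) \<subseteq> set c"
      using in_c pow by auto
    show "set c \<subseteq> range (\<lambda>k. (\<sigma> ^^ k) y)"
    proof
      fix z assume "z \<in> set c"
      then obtain r where r: "r < length c" "z = c ! r"
        by (auto simp: in_set_conv_nth)
      have "(\<sigma> ^^ (r + length c - t)) y = c ! ((r + length c - t + t) mod length c)"
        by (rule nth)
      also have "\<dots> = z" using t r by simp
      finally have "(\<sigma> ^^ (r + length c - t)) y = z" .
      then show "z \<in> range (\<lambda>k. (\<sigma> ^^ k) y)" by blast
    qed
  qed
qed

text \<open>Each list of length \<open>j\<close> consists of \<open>j\<close> points with orbits of size \<open>j\<close>. Hence the
  multiplicities of the positive cycle lengths can be read off from the orbits alone, without the
  chosen decomposition into cycles.\<close>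

lemma count_points_by_orbit_size:
  fixes \<sigma> :: "'a \<Rightarrow> 'a"
  assumes "\<And>c y. c \<in> set L \<Longrightarrow> y \<in> set c \<Longrightarrow> card (range (\<lambda>k. (\<sigma> ^^ k) y)) = length c"
  shows "length (filter (\<lambda>y. card (range (\<lambda>k. (\<sigma> ^^ k) y)) = j) (concat L))
    = j * count (mset (map length L)) j"
  using assms
proof (induction L)
  case (Cons c L)
  have "filter (\<lambda>y. card (range (\<lambda>k. (\<sigma> ^^ k) y)) = j) c = (if length c = j then c else [])"
    using Cons.prems[of c] by (auto simp: filter_empty_conv intro: filter_True)
  moreover have "length (filter (\<lambda>y. card (range (\<lambda>k. (\<sigma> ^^ k) y)) = j) (concat L))
    = j * count (mset (map length L)) j"
    using Cons.prems by (intro Cons.IH) auto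
  ultimately show ?case by simp
qed simp

section \<open>The cycle type of a symmetric permutation\<close>

definition sym_cycles :: "nat \<Rightarrow> nat list list \<Rightarrow> nat list list" where
  "sym_cycles n cs = cs @ map (tau_cycle n) cs"

lemma set_tau_cycle: "set (tau_cycle n c) = tau n ` set c"
  and length_tau_cycle [simp]: "length (tau_cycle n c) = length c"
  by (simp_all add: tau_cycle_def)

lemma mset_concat_tau_cycles: "mset (concat (map (tau_cycle n) cs)) = mset (map (tau n) (concat cs))"
  by (induction cs) (simp_all add: tau_cycle_def)

lemma mset_concat_sym_cycles:
  "mset (concat (sym_cycles n cs)) = mset (concat cs @ map (tau n) (concat cs))"
  by (simp only: sym_cycles_def concat_append mset_append mset_concat_tau_cycles)

lemma B_typeE:
  assumes "\<sigma> \<in> B_type n \<mu>"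
  obtains cs where "mset (map length cs) = \<mu>" "distinct (concat (sym_cycles n cs))"
    "set (concat (sym_cycles n cs)) = {1..2*n}"
    "\<sigma> = comp_list (map cycle_of_list (sym_cycles n cs))"
  using assms by (auto simp: B_type_def sym_cycles_def)

lemma finite_B_type [simp]: "finite (B_type n \<mu>)"
  by (rule finite_subset[OF _ finite_permutations[of "{1..2*n}"]]) (auto simp: B_type_def)

lemma finite_partitions [simp]: "finite (partitions n)"
proof (rule finite_subset)
  show "partitions n \<subseteq> mset ` {xs. set xs \<subseteq> {..n} \<and> length xs \<le> n}"
  proof
    fix \<mu> assume \<mu>: "\<mu> \<in> partitions n"
    obtain xs where xs: "mset xs = \<mu>" using ex_mset by blast
    have s: "sum_list xs = n" "0 \<notin> set xs"
      using \<mu> xs by (auto simp: partitions_def sum_mset_sum_list[symmetric] simp del: sum_mset_sum_list)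
    have "length xs \<le> sum_list xs" if "0 \<notin> set xs" for xs :: "nat list"
      using that by (induction xs) auto
    with s have "length xs \<le> n" by metis
    moreover have "set xs \<subseteq> {..n}" using s member_le_sum_list by fastforce
    ultimately show "\<mu> \<in> mset ` {xs. set xs \<subseteq> {..n} \<and> length xs \<le> n}" using xs by blast
  qed
  show "finite (mset ` {xs. set xs \<subseteq> {..n} \<and> length xs \<le> n})"
    by (intro finite_imageI finite_lists_length_le) simp
qed

text \<open>The factor 2 comes from the pairing: every listed cycle has a \<open>\<tau>\<close>-symmetric partner of the
  same length.\<close>

lemma B_type_orbit_count:
  assumes "\<sigma> \<in> B_type n \<mu>"
  shows "card {y \<in> {1..2*n}. card (range (\<lambda>k. (\<sigma> ^^ k) y)) = j} = 2 * j * count \<mu> j"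
proof -
  let ?P = "\<lambda>y. card (range (\<lambda>k. (\<sigma> ^^ k) y)) = j"
  obtain cs where cs: "mset (map length cs) = \<mu>" "distinct (concat (sym_cycles n cs))"
    "set (concat (sym_cycles n cs)) = {1..2*n}"
    "\<sigma> = comp_list (map cycle_of_list (sym_cycles n cs))"
    using assms by (rule B_typeE)
  have orbit: "card (range (\<lambda>k. (\<sigma> ^^ k) y)) = length c"
    if "c \<in> set (sym_cycles n cs)" "y \<in> set c" for c y
  proof -
    have d: "distinct c" using cs(2) that(1) by (auto simp: distinct_concat_iff)
    have "range (\<lambda>k. (\<sigma> ^^ k) y) = set c"
      using d that(2) unfolding cs(4)
      by (rule cycle_orbit) (rule disjoint_cycles_apply[OF cs(2) that(1)])
    then show ?thesis using d by (simp add: distinct_card)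
  qed
  have "{y \<in> {1..2*n}. ?P y} = set (filter ?P (concat (sym_cycles n cs)))"
    by (simp only: set_filter cs(3))
  also have "card \<dots> = length (filter ?P (concat (sym_cycles n cs)))"
    using cs(2) by (intro distinct_card distinct_filter)
  also have "\<dots> = j * count (mset (map length (sym_cycles n cs))) j"
    by (rule count_points_by_orbit_size) (rule orbit)
  also have "mset (map length (sym_cycles n cs)) = \<mu> + \<mu>"
  proof -
    have "map length (sym_cycles n cs) = map length cs @ map length cs"
      by (simp add: sym_cycles_def)
    then show ?thesis by (simp only: mset_append cs(1))
  qed
  finally show ?thesis by simp
qed

text \<open>Empty cycles leave no trace in the permutation, so the type is an invariant only as long as
  both multisets avoid 0.\<close>

lemma B_type_unique:
  assumes "\<sigma> \<in> B_type n \<mu>" "\<sigma> \<in> B_type n \<nu>" "0 \<notin># \<mu>" "0 \<notin># \<nu>"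
  shows "\<mu> = \<nu>"
proof (rule multiset_eqI)
  fix j
  have "2 * j * count \<mu> j = 2 * j * count \<nu> j"
    unfolding B_type_orbit_count[OF assms(1), of j, symmetric]
    by (rule B_type_orbit_count[OF assms(2)])
  with assms(3,4) show "count \<mu> j = count \<nu> j"
    by (cases "j = 0") (auto simp: not_in_iff)
qed

section \<open>Conjugacy under the hyperoctahedral group\<close>

text \<open>The set \<open>B_type n \<mu>\<close> is a single orbit of the hyperoctahedral group. Two permutations of the
  same type have representatives \<open>cs\<close>, \<open>es\<close> of their pairs of cycles with the same lengths in the
  same order. Their entries \<open>u\<close>, \<open>v\<close> both form a system of representatives for the orbits of \<open>\<tau>\<close>,
  so \<open>u\<^sub>t \<mapsto> v\<^sub>t\<close> together with \<open>\<tau> u\<^sub>t \<mapsto> \<tau> v\<^sub>t\<close> defines a permutation commuting with \<open>\<tau>\<close>. It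
  carries the cycles in \<open>cs\<close> to those in \<open>es\<close>, and because it commutes with \<open>\<tau>\<close> it also carries
  the partners to the partners.\<close>

lemma B_type_conjugate:
  assumes "\<sigma> \<in> B_type n \<mu>" "\<sigma>' \<in> B_type n \<mu>"
  shows "\<exists>x\<in>hyperoct n. x \<circ> \<sigma> \<circ> inv x = \<sigma>'"
proof -
  obtain cs where cs: "mset (map length cs) = \<mu>" "distinct (concat (sym_cycles n cs))"
    "set (concat (sym_cycles n cs)) = {1..2*n}"
    "\<sigma> = comp_list (map cycle_of_list (sym_cycles n cs))"
    using assms(1) by (rule B_typeE)
  obtain ds where ds: "mset (map length ds) = \<mu>" "distinct (concat (sym_cycles n ds))"
    "set (concat (sym_cycles n ds)) = {1..2*n}"
    "\<sigma>' = comp_list (map cycle_of_list (sym_cycles n ds))"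
    using assms(2) by (rule B_typeE)
  obtain es where es: "mset es = mset ds" "map length es = map length cs"
  proof -
    obtain p where p: "p permutes {..<length (map length ds)}"
      "permute_list p (map length ds) = map length cs"
      using mset_eq_permutation[of "map length cs" "map length ds"] cs(1) ds(1) by metis
    show ?thesis
    proof (rule that)
      show "mset (permute_list p ds) = mset ds" using p(1) by simp
      show "map length (permute_list p ds) = map length cs"
        using p by (simp add: permute_list_map)
    qed
  qed
  have "mset (sym_cycles n es) = mset (sym_cycles n ds)"
    using es(1) by (simp add: sym_cycles_def)
  then have \<sigma>': "\<sigma>' = comp_list (map cycle_of_list (sym_cycles n es))"
    using disjoint_cycles_reorder ds(2,4) by metis
  define u v where "u = concat cs" and "v = concat es"
  have len: "length u = length v"
    using es(2) by (simp add: u_def v_def length_concat)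
  have mv: "mset (v @ map (tau n) v) = mset (concat (sym_cycles n ds))"
    unfolding v_def mset_concat_sym_cycles[symmetric]
    by (rule mset_concat_cong) fact
  have mu: "mset (u @ map (tau n) u) = mset (concat (sym_cycles n cs))"
    by (simp only: u_def mset_concat_sym_cycles)
  have du: "distinct (u @ map (tau n) u)" and dv: "distinct (v @ map (tau n) v)"
    using cs(2) ds(2) mset_eq_imp_distinct_iff mu mv by blast+
  have su: "set (u @ map (tau n) u) = {1..2*n}" and sv: "set (v @ map (tau n) v) = {1..2*n}"
    using cs(3) ds(3) mset_eq_setD mu mv by metis+
  let ?w = "u @ map (tau n) u" and ?w' = "v @ map (tau n) v"
  define x where "x = permutation_of_list (zip ?w ?w')"
  have lw: "length ?w = length ?w'" using len by simp
  have x_perm: "x permutes {1..2*n}"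
    unfolding x_def
  proof (rule permutation_of_list_permutes)
    show "list_permutes (zip ?w ?w') {1..2*n}"
      unfolding list_permutes_def map_fst_zip[OF lw] map_snd_zip[OF lw] su sv
      using du dv by blast
  qed
  have "map x ?w = ?w'"
  proof (rule nth_equalityI)
    fix t assume "t < length (map x ?w)"
    then have t: "t < length ?w" by simp
    have "map_of (zip ?w ?w') (?w ! t) = Some (?w' ! t)"
      by (rule map_of_zip_nth) (use lw du t in simp_all)
    then have "x (?w ! t) = ?w' ! t"
      by (simp add: x_def permutation_of_list_def)
    then show "map x ?w ! t = ?w' ! t" using t by (simp only: nth_map)
  qed (use lw in simp)
  then have xu: "map x u = v" and xtu: "map x (map (tau n) u) = map (tau n) v"
    using len by simp_all
  have comm_u: "x (tau n y) = tau n (x y)" if "y \<in> set u" for y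
    using xtu that unfolding xu[symmetric] by simp
  have comm: "x (tau n y) = tau n (x y)" for y
  proof (cases "y \<in> {1..2*n}")
    case True
    then consider "y \<in> set u" | z where "z \<in> set u" "y = tau n z"
      unfolding su[symmetric] by auto
    then show ?thesis
      by cases (simp_all add: comm_u)
  next
    case False
    then show ?thesis using x_perm by (metis permutes_not_in tau_mem_iff tau_outside)
  qed
  have x: "x \<in> hyperoct n"
    using x_perm comm by (auto simp: hyperoct_def)
  have cs_es: "map (map x) cs = es"
  proof (rule concat_injective)
    show "concat (map (map x) cs) = concat es"
      using xu by (simp add: u_def v_def map_concat)
    show "length (map (map x) cs) = length es"
      using arg_cong[OF es(2), of length] by simp
    have "length (cs ! i) = length (es ! i)" if "i < length cs" for i
      using es(2) that by (metis length_map nth_map)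
    then show "\<forall>(a, b) \<in> set (zip (map (map x) cs) es). length a = length b"
      by (auto simp: in_set_zip)
  qed
  have "tau_cycle n (map x c) = map x (tau_cycle n c)" for c
    by (simp add: tau_cycle_def rev_map comm)
  then have sym_es: "sym_cycles n es = map (map x) (sym_cycles n cs)"
    unfolding cs_es[symmetric] by (simp add: sym_cycles_def)
  have "x \<circ> \<sigma> \<circ> inv x = comp_list (map (\<lambda>c. x \<circ> cycle_of_list c \<circ> inv x) (sym_cycles n cs))"
    unfolding cs(4) comp_list_conj[OF hyperoct_bij[OF x]] by (simp add: comp_def)
  also have "map (\<lambda>c. x \<circ> cycle_of_list c \<circ> inv x) (sym_cycles n cs)
      = map (\<lambda>c. cycle_of_list (map x c)) (sym_cycles n cs)"
    using cs(2) by (intro map_cong refl conjugation_of_cycle[OF _ hyperoct_bij[OF x]])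
      (auto simp: distinct_concat_iff)
  also have "comp_list \<dots> = \<sigma>'"
    unfolding \<sigma>' sym_es by (simp add: comp_def)
  finally show ?thesis using x by blast
qed

section \<open>Pairing the cycles of a product of two fixed-point-free involutions\<close>

text \<open>The hypothesis on \<open>\<sigma>\<close> is \<open>\<tau> \<sigma> \<tau> = \<sigma>\<inverse>\<close>. If \<open>\<sigma>\<close> runs through \<open>c\<close> forwards, then it runs through
  \<open>\<tau> c\<close> backwards, which is why \<open>tau_cycle\<close> reverses the list.\<close>

lemma tau_cycle_apply:
  assumes \<sigma>: "\<And>y. \<sigma> (tau n (\<sigma> y)) = tau n y"
    and c: "distinct c" "\<And>y. y \<in> set c \<Longrightarrow> \<sigma> y = cycle_of_list c y"
    and y: "y \<in> set (tau_cycle n c)"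
  shows "\<sigma> y = cycle_of_list (tau_cycle n c) y"
proof -
  have "map (cycle_of_list c) c = rotate1 c"
    using cyclic_rotation[OF c(1), of 1] by simp
  then have c_rot: "map \<sigma> c = rotate1 c"
    using c(2) by (metis map_cong)
  have "map \<sigma> (tau_cycle n c) = rotate1 (tau_cycle n c)"
  proof (cases c)
    case (Cons b d)
    have "map (\<sigma> \<circ> tau n) (d @ [b]) = map (\<sigma> \<circ> tau n) (map \<sigma> c)"
      using c_rot Cons by simp
    also have "\<dots> = map (tau n) (b # d)"
      using Cons \<sigma> by simp
    finally have eq: "map (\<sigma> \<circ> tau n) (d @ [b]) = map (tau n) (b # d)" .
    show ?thesis
    proof (cases d rule: rev_cases)
      case Nil
      with eq Cons show ?thesis by (simp add: tau_cycle_def)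
    next
      case (snoc d' a)
      with eq have "map (\<sigma> \<circ> tau n) d @ [\<sigma> (tau n b)] = (tau n b # map (tau n) d') @ [tau n a]"
        by simp
      then have "map (\<sigma> \<circ> tau n) d = tau n b # map (tau n) d'" "\<sigma> (tau n b) = tau n a"
        by (simp_all only: append1_eq_conv)
      then have "rev (map (\<sigma> \<circ> tau n) d) @ [\<sigma> (tau n b)] = rev (map (tau n) d') @ [tau n b, tau n a]"
        by simp
      with snoc Cons show ?thesis
        by (simp add: tau_cycle_def rev_map)
    qed
  qed (simp add: tau_cycle_def)
  moreover have "distinct (tau_cycle n c)"
    using c(1) by (simp add: tau_cycle_def distinct_map inj_on_def)
  then have "map (cycle_of_list (tau_cycle n c)) (tau_cycle n c) = rotate1 (tau_cycle n c)"
    using cyclic_rotation[of "tau_cycle n c" 1] by simp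
  ultimately show ?thesis
    using y map_eq_conv by metis
qed

text \<open>This is \<open>\<tau> \<sigma>\<^sup>l \<tau> = \<sigma>\<^sup>-\<^sup>l\<close>, written without inverses.\<close>

lemma funpow_tau:
  assumes "\<And>y. \<sigma> (tau n (\<sigma> y)) = tau n y"
  shows "(\<sigma> ^^ l) (tau n ((\<sigma> ^^ l) y)) = tau n y"
proof (induction l arbitrary: y)
  case (Suc l)
  have "(\<sigma> ^^ Suc l) (tau n ((\<sigma> ^^ Suc l) y)) = \<sigma> ((\<sigma> ^^ l) (tau n ((\<sigma> ^^ l) (\<sigma> y))))"
    by (simp add: funpow_swap1)
  then show ?case by (simp add: Suc assms)
qed simp

text \<open>Since \<open>\<tau> \<sigma> \<tau> = \<sigma>\<inverse>\<close>, the map \<open>\<tau>\<close> acts on an orbit that it preserves as a reflection of a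
  regular polygon. A reflection fixes a vertex or swaps two neighbouring ones; in the first case \<open>\<tau>\<close> has a
  fixed point \<open>z\<close>, in the second \<open>\<sigma> z = \<tau> z\<close> for some \<open>z\<close>. (A polygon with an odd number of
  vertices falls under both.) For \<open>\<tau> y = \<sigma>\<^sup>k y\<close> the point \<open>z\<close> lies
  halfway between \<open>y\<close> and \<open>\<tau> y\<close>, and the parity of \<open>k\<close> separates the two cases.\<close>

lemma tau_not_in_orbit:
  assumes \<sigma>: "\<sigma> permutes {1..2*n}" "\<And>y. \<sigma> (tau n (\<sigma> y)) = tau n y"
    and free: "\<And>y. y \<in> {1..2*n} \<Longrightarrow> \<sigma> y \<noteq> tau n y"
    and y: "y \<in> {1..2*n}"
  shows "tau n y \<noteq> (\<sigma> ^^ k) y"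
proof
  assume k: "tau n y = (\<sigma> ^^ k) y"
  define l where "l = k div 2"
  define z where "z = (\<sigma> ^^ l) y"
  have z: "z \<in> {1..2*n}"
    unfolding z_def using permutes_in_image[OF permutes_funpow[OF \<sigma>(1)]] y by blast
  have inj: "inj (\<sigma> ^^ l)"
    using \<sigma>(1) permutes_funpow permutes_inj by blast
  have "(\<sigma> ^^ l) (tau n z) = tau n y"
    unfolding z_def by (rule funpow_tau) (rule \<sigma>(2))
  also have "\<dots> = (\<sigma> ^^ l) (if even k then z else \<sigma> z)"
  proof -
    have "k = l + l \<or> k = l + Suc l"
      unfolding l_def by presburger
    moreover have "even k \<longleftrightarrow> k = l + l"
      unfolding l_def by presburger
    ultimately show ?thesis
      unfolding k z_def by (auto simp: funpow_add funpow_swap1)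
  qed
  finally have "tau n z = (if even k then z else \<sigma> z)"
    using inj by (simp add: inj_eq)
  with z tau_fixed_point_free free show False
    by (metis (full_types))
qed

text \<open>Peel off one pair of cycles at a time: the cycle \<open>C\<close> of a point \<open>x\<close> is disjoint from its image
  \<open>T\<close> under \<open>\<tau>\<close>, because \<open>\<tau>\<close> maps no point into its own orbit, and the complement of \<open>C \<union> T\<close> is
  again stable under \<open>\<sigma>\<close> and \<open>\<tau>\<close>.\<close>

lemma symmetric_cycles_exist:
  assumes \<sigma>: "\<sigma> permutes {1..2*n}" "\<And>y. \<sigma> (tau n (\<sigma> y)) = tau n y"
    and free: "\<And>y. y \<in> {1..2*n} \<Longrightarrow> \<sigma> y \<noteq> tau n y"
    and S: "S \<subseteq> {1..2*n}" "\<sigma> ` S \<subseteq> S" "tau n ` S \<subseteq> S"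
  shows "\<exists>cs. distinct (concat (sym_cycles n cs)) \<and> set (concat (sym_cycles n cs)) = S \<and>
    [] \<notin> set cs \<and> (\<forall>c\<in>set (sym_cycles n cs). \<forall>y\<in>set c. \<sigma> y = cycle_of_list c y)"
proof -
  have "finite S" using S(1) finite_subset by blast
  then show ?thesis using S
  proof (induction S rule: finite_psubset_induct)
    case (psubset S)
    show ?case
    proof (cases "S = {}")
      case True
      then show ?thesis by (intro exI[of _ "[]"]) (simp add: sym_cycles_def)
    next
      case False
      then obtain x where x: "x \<in> S" by blast
      have perm: "permutation \<sigma>"
        using \<sigma>(1) permutation_permutes by blast
      have self: "a \<in> set (support \<sigma> a)" for a
        unfolding support_set[OF perm] by (rule range_eqI[of _ _ 0]) simp
      have step: "\<sigma> a \<in> set (support \<sigma> a)" for a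
        unfolding support_set[OF perm] by (rule range_eqI[of _ _ 1]) simp
      have same: "set (support \<sigma> a) = set (support \<sigma> b)"
        if "y \<in> set (support \<sigma> a)" "y \<in> set (support \<sigma> b)" for a b y
        using disjoint_support[OF perm] that unfolding disjoint_def by blast
      define c where "c = support \<sigma> x"
      define C where "C = set c"
      define T where "T = tau n ` C"
      have C_step: "\<sigma> a \<in> C \<longleftrightarrow> a \<in> C" for a
        using same step self unfolding C_def c_def by blast
      have c_dist: "distinct c"
        unfolding c_def by (rule cycle_of_permutation[OF perm])
      have c_apply: "\<sigma> y = cycle_of_list c y" if "y \<in> set c" for y
        using that unfolding c_def by (rule cycle_restrict[OF perm])
      have CS: "C \<subseteq> S"
      proof -
        have "(\<sigma> ^^ k) x \<in> S" for k
          using x psubset.prems(2) by (induction k) auto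
        then show ?thesis by (auto simp: C_def c_def)
      qed
      have TS: "T \<subseteq> S" using CS psubset.prems(3) by (auto simp: T_def)
      have xC: "x \<in> C" using self by (simp add: C_def c_def)
      have CT: "C \<inter> T = {}"
      proof (rule ccontr)
        assume "C \<inter> T \<noteq> {}"
        then obtain a where a: "a \<in> C" "tau n a \<in> C"
          unfolding T_def by blast
        then have "tau n a \<in> set (support \<sigma> a)"
          using same self unfolding C_def c_def by blast
        then obtain k where "tau n a = (\<sigma> ^^ k) a"
          unfolding support_set[OF perm] by blast
        then show False
          using tau_not_in_orbit[OF \<sigma> free] a(1) CS psubset.prems(1) by blast
      qed
      have T_step: "a \<in> T" if "\<sigma> a \<in> T" for a
      proof -
        from that have "tau n (\<sigma> a) \<in> C" by (auto simp: T_def)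
        then have "\<sigma> (tau n (\<sigma> a)) \<in> C" by (simp only: C_step)
        then have "tau n a \<in> C" by (simp only: \<sigma>(2))
        then show "a \<in> T" unfolding T_def by (rule image_eqI[rotated]) simp
      qed
      have T_tau: "a \<in> T" if "tau n a \<in> C" for a
        using that unfolding T_def by (rule image_eqI[rotated]) simp
      have C_tau: "a \<in> C" if "tau n a \<in> T" for a
        using that unfolding T_def by auto
      have "\<exists>cs. distinct (concat (sym_cycles n cs)) \<and> set (concat (sym_cycles n cs)) = S - (C \<union> T) \<and>
        [] \<notin> set cs \<and> (\<forall>c\<in>set (sym_cycles n cs). \<forall>y\<in>set c. \<sigma> y = cycle_of_list c y)"
      proof (rule psubset.IH)
        show "S - (C \<union> T) \<subset> S" using x xC by blast
        show "S - (C \<union> T) \<subseteq> {1..2*n}" using psubset.prems(1) by blast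
        show "\<sigma> ` (S - (C \<union> T)) \<subseteq> S - (C \<union> T)"
          using psubset.prems(2) C_step T_step by blast
        show "tau n ` (S - (C \<union> T)) \<subseteq> S - (C \<union> T)"
          using psubset.prems(3) T_tau C_tau by blast
      qed
      then obtain cs where cs: "distinct (concat (sym_cycles n cs))"
        "set (concat (sym_cycles n cs)) = S - (C \<union> T)" "[] \<notin> set cs"
        "\<forall>c\<in>set (sym_cycles n cs). \<forall>y\<in>set c. \<sigma> y = cycle_of_list c y"
        by blast
      have setT: "set (tau_cycle n c) = T"
        by (simp add: set_tau_cycle T_def C_def)
      have mset_eq: "mset (concat (sym_cycles n (c # cs)))
        = mset (c @ tau_cycle n c @ concat (sym_cycles n cs))"
        by (simp add: sym_cycles_def)
      have "distinct (tau_cycle n c)"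
        using c_dist by (simp add: tau_cycle_def distinct_map inj_on_def)
      then have "distinct (c @ tau_cycle n c @ concat (sym_cycles n cs))"
        using c_dist cs(1) CT unfolding distinct_append set_append setT cs(2) C_def[symmetric]
        by blast
      then have "distinct (concat (sym_cycles n (c # cs)))"
        using mset_eq mset_eq_imp_distinct_iff by blast
      moreover have "set (concat (sym_cycles n (c # cs))) = S"
        using CS TS unfolding mset_eq_setD[OF mset_eq] set_append setT cs(2) C_def[symmetric]
        by blast
      moreover have "[] \<notin> set (c # cs)"
        using cs(3) xC by (auto simp: C_def)
      moreover have "\<sigma> y = cycle_of_list d y" if "d \<in> set (sym_cycles n (c # cs))" "y \<in> set d" for d y
      proof -
        from that(1) consider "d = c" | "d = tau_cycle n c" | "d \<in> set (sym_cycles n cs)"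
          by (auto simp: sym_cycles_def)
        then show ?thesis
        proof cases
          case 1
          then show ?thesis using c_apply that(2) by blast
        next
          case 2
          then show ?thesis using tau_cycle_apply[OF \<sigma>(2) c_dist c_apply] that(2) by blast
        next
          case 3
          then show ?thesis using cs(4) that(2) by blast
        qed
      qed
      ultimately show ?thesis by blast
    qed
  qed
qed

text \<open>The hypotheses say that \<open>\<sigma> \<tau>\<close> is an involution without fixed points on \<open>{1..2n}\<close>. Such an
  element has a cycle decomposition into \<open>\<tau>\<close>-symmetric pairs.\<close>

lemma B_twistedI:
  assumes \<sigma>: "\<sigma> permutes {1..2*n}" "\<And>y. \<sigma> (tau n (\<sigma> y)) = tau n y"
    and free: "\<And>y. y \<in> {1..2*n} \<Longrightarrow> \<sigma> y \<noteq> tau n y"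
  shows "\<sigma> \<in> B_twisted n"
proof -
  have "\<sigma> ` {1..2*n} \<subseteq> {1..2*n}" "tau n ` {1..2*n} \<subseteq> {1..2*n}"
    using permutes_image[OF \<sigma>(1)] permutes_image[OF tau_permutes] by simp_all
  from symmetric_cycles_exist[OF \<sigma> free subset_refl this] obtain cs where
    cs: "distinct (concat (sym_cycles n cs))" "set (concat (sym_cycles n cs)) = {1..2*n}"
      "[] \<notin> set cs" "\<forall>c\<in>set (sym_cycles n cs). \<forall>y\<in>set c. \<sigma> y = cycle_of_list c y"
    by blast
  have "\<sigma> = comp_list (map cycle_of_list (sym_cycles n cs))"
  proof
    fix y
    show "\<sigma> y = comp_list (map cycle_of_list (sym_cycles n cs)) y"
    proof (cases "y \<in> set (concat (sym_cycles n cs))")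
      case True
      then obtain c where c: "c \<in> set (sym_cycles n cs)" "y \<in> set c" by auto
      show ?thesis
        using cs(4) c disjoint_cycles_apply[OF cs(1) c] by simp
    next
      case False
      then show ?thesis
        using \<sigma>(1) permutes_not_in cs(2) by (metis disjoint_cycles_outside)
    qed
  qed
  moreover have "tau n \<circ> \<sigma> \<circ> tau n = inv \<sigma>"
  proof (rule inv_unique_comp[symmetric])
    show "\<sigma> \<circ> (tau n \<circ> \<sigma> \<circ> tau n) = id" "tau n \<circ> \<sigma> \<circ> tau n \<circ> \<sigma> = id"
      by (simp_all add: fun_eq_iff \<sigma>(2))
  qed
  ultimately have "\<sigma> \<in> B_type n (mset (map length cs))"
    unfolding B_type_def using \<sigma>(1) cs(1,2) unfolding sym_cycles_def by blast
  moreover have "mset (map length cs) \<in> partitions n"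
  proof -
    have "2 * n = length (concat (sym_cycles n cs))"
      using distinct_card[OF cs(1)] cs(2) by simp
    also have "\<dots> = length (concat cs @ map (tau n) (concat cs))"
      using mset_concat_sym_cycles by (metis size_mset)
    finally have "n = sum_list (map length cs)"
      by (simp add: length_concat)
    then show ?thesis
      using cs(3) by (auto simp: partitions_def sum_mset_sum_list simp flip: mset_map)
  qed
  ultimately show ?thesis
    by (auto simp: B_twisted_def)
qed

section \<open>Products along sequences of transpositions\<close>

text \<open>The product \<open>\<sigma>\<^sub>1 \<cdots> \<sigma>\<^sub>m (\<tau> \<sigma>\<^sub>m \<tau>) \<cdots> (\<tau> \<sigma>\<^sub>1 \<tau>)\<close> by whose type Hurwitz sequences are counted.\<close>

definition twisted_prod :: "nat \<Rightarrow> (nat \<Rightarrow> nat) list \<Rightarrow> nat \<Rightarrow> nat" where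
  "twisted_prod n ss = comp_list (ss @ rev (map (\<lambda>s. tau n \<circ> s \<circ> tau n) ss))"

definition admissible_sequences :: "nat \<Rightarrow> nat \<Rightarrow> (nat \<Rightarrow> nat) list set" where
  "admissible_sequences n m = {ss. length ss = m \<and> set ss \<subseteq> admissible_transpositions n}"

lemma twisted_prod_Nil [simp]: "twisted_prod n [] = id"
  by (simp add: twisted_prod_def)

text \<open>The nested shape of the product is the source of the cut-and-join recursion: a further
  transposition in front acts on the old product from both sides, exactly as a summand of
  \<open>cut_join_alg\<close> does.\<close>

lemma twisted_prod_Cons:
  "twisted_prod n (s # ss) = s \<circ> twisted_prod n ss \<circ> (tau n \<circ> s \<circ> tau n)"
  by (simp add: twisted_prod_def comp_assoc)

lemma tau_conj_transpose:
  "tau n \<circ> transpose i j \<circ> tau n = transpose (tau n i) (tau n j)"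
proof
  fix k
  have "tau n k = l \<longleftrightarrow> k = tau n l" for l
    by auto
  then show "(tau n \<circ> transpose i j \<circ> tau n) k = transpose (tau n i) (tau n j) k"
    by (simp add: transpose_def)
qed

lemma twisted_prod_conj:
  assumes "x \<in> hyperoct n"
  shows "twisted_prod n (map (\<lambda>s. x \<circ> s \<circ> inv x) ss) = x \<circ> twisted_prod n ss \<circ> inv x"
proof (induction ss)
  case Nil
  show ?case
    using hyperoct_bij[OF assms] by (simp add: fun_eq_iff bij_is_surj surj_f_inv_f)
next
  case (Cons s ss)
  have "inv x (x y) = y" for y
    using hyperoct_bij[OF assms] by (simp add: bij_is_inj)
  then show ?case
    unfolding list.map twisted_prod_Cons Cons.IH
    by (simp add: fun_eq_iff hyperoct_apply_tau[OF assms, symmetric]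
        hyperoct_apply_tau[OF hyperoct_inv[OF assms]])
qed

text \<open>With \<open>a = \<sigma>\<^sub>1 \<cdots> \<sigma>\<^sub>m\<close>, the second half of the product is \<open>\<tau> a\<inverse> \<tau>\<close>, as transpositions are their
  own inverses.\<close>

lemma twisted_prod_eq:
  assumes "set ss \<subseteq> admissible_transpositions n"
  shows "\<exists>a. a permutes {1..2*n} \<and> twisted_prod n ss = a \<circ> tau n \<circ> inv a \<circ> tau n"
  using assms
proof (induction ss)
  case Nil
  have "id permutes {1..2*n} \<and> twisted_prod n [] = id \<circ> tau n \<circ> inv id \<circ> tau n"
    by (simp add: permutes_id)
  then show ?case by blast
next
  case (Cons s ss)
  then obtain a where a: "a permutes {1..2*n}" "twisted_prod n ss = a \<circ> tau n \<circ> inv a \<circ> tau n"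
    by (metis set_subset_Cons subset_trans)
  from Cons.prems obtain i j where s: "s = transpose i j" "i \<in> {1..2*n}" "j \<in> {1..2*n}"
    by (auto simp: admissible_transpositions_def)
  have "s \<circ> a permutes {1..2*n}"
    unfolding s(1) by (intro permutes_compose a permutes_swap_id s)
  moreover have "inv (s \<circ> a) = inv a \<circ> s"
    unfolding s(1) using o_inv_distrib[OF bij_transpose permutes_bij[OF a(1)]] by simp
  then have "twisted_prod n (s # ss) = (s \<circ> a) \<circ> tau n \<circ> inv (s \<circ> a) \<circ> tau n"
    unfolding twisted_prod_Cons a(2) by (simp add: fun_eq_iff)
  ultimately show ?case by blast
qed

text \<open>If the product is \<open>\<sigma> = a \<tau> a\<inverse> \<tau>\<close>, then \<open>\<sigma> \<tau>\<close> is conjugate to \<open>\<tau>\<close> and so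
  it is an involution without fixed points.\<close>

lemma twisted_prod_in_B_twisted:
  assumes "ss \<in> admissible_sequences n m"
  shows "twisted_prod n ss \<in> B_twisted n"
proof -
  obtain a where a: "a permutes {1..2*n}" "twisted_prod n ss = a \<circ> tau n \<circ> inv a \<circ> tau n"
    using assms twisted_prod_eq unfolding admissible_sequences_def by blast
  show ?thesis
  proof (rule B_twistedI)
    show "twisted_prod n ss permutes {1..2*n}"
      unfolding a(2) by (intro permutes_compose permutes_inv a(1) tau_permutes)
    show "twisted_prod n ss (tau n (twisted_prod n ss y)) = tau n y" for y
      unfolding a(2) by (simp add: permutes_inverses[OF a(1)])
    show "twisted_prod n ss y \<noteq> tau n y" if "y \<in> {1..2*n}" for y
    proof
      let ?z = "inv a (tau n y)"
      assume "twisted_prod n ss y = tau n y"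
      then have "a (tau n ?z) = tau n y"
        by (simp add: a(2))
      then have "tau n ?z = ?z"
        using permutes_inverses(2)[OF a(1)] by metis
      moreover have "?z \<in> {1..2*n}"
        using that permutes_in_image[OF permutes_inv[OF a(1)]] tau_mem_iff by metis
      ultimately show False
        using tau_fixed_point_free by blast
    qed
  qed
qed

lemma finite_admissible_transpositions [simp]: "finite (admissible_transpositions n)"
proof (rule finite_subset)
  show "admissible_transpositions n \<subseteq> (\<lambda>(i, j). transpose i j) ` ({1..2*n} \<times> {1..2*n})"
    by (auto simp: admissible_transpositions_def)
qed simp

lemma finite_admissible_sequences [simp]: "finite (admissible_sequences n m)"
  unfolding admissible_sequences_def
  using finite_lists_length_eq[OF finite_admissible_transpositions] by (simp add: conj_commute)

lemma admissible_conj: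
  assumes x: "x \<in> hyperoct n" and s: "s \<in> admissible_transpositions n"
  shows "x \<circ> s \<circ> inv x \<in> admissible_transpositions n"
proof -
  obtain i j where ij: "s = transpose i j" "i \<in> {1..2*n}" "j \<in> {1..2*n}" "i \<noteq> j" "j \<noteq> tau n i"
    using s by (auto simp: admissible_transpositions_def)
  have b: "bij x" by (rule hyperoct_bij[OF x])
  have "x \<circ> s \<circ> inv x = transpose (x i) (x j)"
    using conjugation_of_cycle[of "[i, j]" x] ij b by simp
  moreover have "x permutes {1..2*n}" using x by (simp add: hyperoct_def)
  then have "x i \<in> {1..2*n}" "x j \<in> {1..2*n}"
    using ij permutes_in_image by metis+
  moreover have "x i \<noteq> x j" "x j \<noteq> tau n (x i)"
    using ij(4,5) bij_is_inj[OF b] by (simp_all add: hyperoct_apply_tau[OF x, symmetric] inj_eq)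
  ultimately show ?thesis
    unfolding admissible_transpositions_def by blast
qed

lemma bij_betw_conj_sequences:
  assumes x: "x \<in> hyperoct n"
  shows "bij_betw (map (\<lambda>s. x \<circ> s \<circ> inv x)) (admissible_sequences n m) (admissible_sequences n m)"
proof (rule bij_betw_byWitness[where f' = "map (\<lambda>s. inv x \<circ> s \<circ> x)"])
  have b: "bij x" by (rule hyperoct_bij[OF x])
  have *: "inv x (x y) = y" "x (inv x y) = y" for y
    using b by (simp_all add: bij_is_inj bij_is_surj surj_f_inv_f)
  have **: "x \<circ> (inv x \<circ> s \<circ> x) \<circ> inv x = s" "inv x \<circ> (x \<circ> s \<circ> inv x) \<circ> x = s" for s
    by (simp_all add: fun_eq_iff *)
  show "\<forall>ss\<in>admissible_sequences n m. map (\<lambda>s. inv x \<circ> s \<circ> x) (map (\<lambda>s. x \<circ> s \<circ> inv x) ss) = ss"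
    "\<forall>ss\<in>admissible_sequences n m. map (\<lambda>s. x \<circ> s \<circ> inv x) (map (\<lambda>s. inv x \<circ> s \<circ> x) ss) = ss"
    by (simp_all only: map_map comp_def[of _ "\<lambda>s. _ \<circ> s \<circ> _"] ** map_ident) simp_all
  show "map (\<lambda>s. x \<circ> s \<circ> inv x) ` admissible_sequences n m \<subseteq> admissible_sequences n m"
    using admissible_conj[OF x] unfolding admissible_sequences_def by fastforce
  show "map (\<lambda>s. inv x \<circ> s \<circ> x) ` admissible_sequences n m \<subseteq> admissible_sequences n m"
    using admissible_conj[OF hyperoct_inv[OF x]]
    unfolding inv_inv_eq[OF b] admissible_sequences_def by fastforce
qed

text \<open>The sum over ordered pairs \<open>i < j\<close> in \<open>cut_join_alg\<close> meets every admissible transposition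
  once.\<close>

lemma bij_betw_transpositions:
  "bij_betw (\<lambda>(i, j). transpose i j) {(i, j). 1 \<le> i \<and> i < j \<and> j \<le> 2*n \<and> j \<noteq> tau n i}
     (admissible_transpositions n)"
proof (rule bij_betw_imageI)
  show "inj_on (\<lambda>(i, j). transpose i j) {(i, j). 1 \<le> i \<and> i < j \<and> j \<le> 2*n \<and> j \<noteq> tau n i}"
  proof (rule inj_onI, clarify)
    fix i j k l :: nat
    assume eq: "transpose i j = transpose k l" and "i < j" "k < l"
    have "transpose k l i = j" "transpose k l j = i"
      unfolding eq[symmetric] by simp_all
    with \<open>i < j\<close> \<open>k < l\<close> show "i = k \<and> j = l"
      by (auto simp: transpose_def split: if_splits)
  qed
  show "(\<lambda>(i, j). transpose i j) ` {(i, j). 1 \<le> i \<and> i < j \<and> j \<le> 2*n \<and> j \<noteq> tau n i}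
    = admissible_transpositions n"
  proof (intro equalityI subsetI)
    fix s assume "s \<in> admissible_transpositions n"
    then obtain i j where ij: "s = transpose i j" "i \<in> {1..2*n}" "j \<in> {1..2*n}" "i \<noteq> j" "j \<noteq> tau n i"
      by (auto simp: admissible_transpositions_def)
    have "s = transpose (min i j) (max i j)"
      using ij(1) by (simp add: min_def max_def transpose_commute)
    moreover have "max i j \<noteq> tau n (min i j)"
      using ij(5) tau_tau[of n j] by (auto simp: min_def max_def)
    ultimately show "s \<in> (\<lambda>(i, j). transpose i j) ` {(i, j). 1 \<le> i \<and> i < j \<and> j \<le> 2*n \<and> j \<noteq> tau n i}"
      using ij(2-4) by (intro image_eqI[of _ _ "(min i j, max i j)"]) auto
  next
    fix s
    assume "s \<in> (\<lambda>(i, j). transpose i j) ` {(i, j). 1 \<le> i \<and> i < j \<and> j \<le> 2*n \<and> j \<noteq> tau n i}"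
    then show "s \<in> admissible_transpositions n"
      by (force simp: admissible_transpositions_def)
  qed
qed

section \<open>Linear extension to formal combinations\<close>

text \<open>A function on combinations that is given by a sum over the support can be evaluated termwise on
  any sum of monomials, even when the monomials coincide or cancel. It is used for
  \<open>conj_comb\<close> and for \<open>cut_join_alg\<close>.\<close>

lemma sum_keys_sum_single:
  fixes F :: "'a \<Rightarrow> 'b::comm_monoid_add \<Rightarrow> 'c::comm_monoid_add"
    and g :: "'i \<Rightarrow> 'a" and a :: "'i \<Rightarrow> 'b"
  assumes "finite I" and F: "\<And>k. F k 0 = 0" "\<And>k a b. F k (a + b) = F k a + F k b"
  defines "y \<equiv> \<Sum>i\<in>I. Poly_Mapping.single (g i) (a i)"
  shows "(\<Sum>k\<in>Poly_Mapping.keys y. F k (Poly_Mapping.lookup y k)) = (\<Sum>i\<in>I. F (g i) (a i))"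
  unfolding y_def using assms(1)
proof (induction I rule: finite_induct)
  case (insert i I)
  let ?y = "\<Sum>i\<in>I. Poly_Mapping.single (g i) (a i)"
  have "(\<Sum>k\<in>Poly_Mapping.keys (Poly_Mapping.single (g i) (a i)).
      F k (Poly_Mapping.lookup (Poly_Mapping.single (g i) (a i)) k)) = F (g i) (a i)"
    by (cases "a i = 0") (simp_all add: F)
  with insert show ?case
    by (simp add: setsum_keys_plus_distrib[of F, OF F])
qed simp

lemma lookup_cscale [simp]: "Poly_Mapping.lookup (cscale c f) k = c * Poly_Mapping.lookup f k"
  by (simp add: cscale_def Poly_Mapping.map.rep_eq when_def)

lemma lookup_class_sum:
  "Poly_Mapping.lookup (class_sum n \<mu>) \<sigma> = (if \<sigma> \<in> B_type n \<mu> then 1 else 0)"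
  by (simp add: class_sum_def lookup_sum lookup_single when_def)

section \<open>Power-sum monomials are independent\<close>

definition exponents :: "nat multiset \<Rightarrow> nat \<Rightarrow>\<^sub>0 nat" where
  "exponents \<mu> = (\<Sum>k\<in>#\<mu>. Poly_Mapping.single k 1)"

lemma lookup_exponents: "Poly_Mapping.lookup (exponents \<mu>) k = count \<mu> k"
  by (induction \<mu>) (simp_all add: exponents_def lookup_add lookup_single when_def)

lemma p_part_eq: "p_part \<mu> = Poly_Mapping.single (exponents \<mu>) 1"
  by (induction \<mu>) (simp_all add: p_part_def pvar_def exponents_def mult_single)

lemma exponents_eq_iff: "exponents \<mu> = exponents \<nu> \<longleftrightarrow> \<mu> = \<nu>"
  by (metis lookup_exponents multiset_eqI)

lemma lookup_sum_p_part:
  assumes "finite M" "\<nu> \<in> M"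
  shows "Poly_Mapping.lookup (\<Sum>\<mu>\<in>M. cscale (d \<mu>) (p_part \<mu>)) (exponents \<nu>) = d \<nu>"
proof -
  have "Poly_Mapping.lookup (\<Sum>\<mu>\<in>M. cscale (d \<mu>) (p_part \<mu>)) (exponents \<nu>)
      = (\<Sum>\<mu>\<in>M. if \<mu> = \<nu> then d \<mu> else 0)"
    by (auto simp: lookup_sum p_part_eq lookup_single when_def exponents_eq_iff intro!: sum.cong)
  with assms show ?thesis by simp
qed

section \<open>Invariant combinations and their polynomials\<close>

lemma lookup_sum_class_sum:
  assumes "\<sigma> \<in> B_type n \<mu>" "\<mu> \<in> partitions n"
  shows "Poly_Mapping.lookup (\<Sum>\<nu>\<in>partitions n. cscale (c \<nu>) (class_sum n \<nu>)) \<sigma> = c \<mu>"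
proof -
  have "Poly_Mapping.lookup (\<Sum>\<nu>\<in>partitions n. cscale (c \<nu>) (class_sum n \<nu>)) \<sigma>
      = (\<Sum>\<nu>\<in>partitions n. if \<nu> = \<mu> then c \<nu> else 0)"
    unfolding lookup_sum
  proof (rule sum.cong)
    fix \<nu> assume "\<nu> \<in> partitions n"
    then have "\<sigma> \<in> B_type n \<nu> \<longleftrightarrow> \<nu> = \<mu>"
      using assms B_type_unique by (auto simp: partitions_def)
    then show "Poly_Mapping.lookup (cscale (c \<nu>) (class_sum n \<nu>)) \<sigma> = (if \<nu> = \<mu> then c \<nu> else 0)"
      by (simp add: lookup_class_sum)
  qed simp
  with assms show ?thesis by simp
qed

text \<open>Invariance under conjugation says that coefficients agree along the orbits of the hyperoctahedral
  group, and each \<open>B_type n \<mu>\<close> lies in one orbit.\<close>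

lemma Z_twisted_constant_on_B_type:
  assumes y: "y \<in> Z_twisted n" and \<sigma>: "\<sigma> \<in> B_type n \<mu>" "\<sigma>' \<in> B_type n \<mu>"
  shows "Poly_Mapping.lookup y \<sigma> = Poly_Mapping.lookup y \<sigma>'"
proof -
  obtain x where x: "x \<in> hyperoct n" "x \<circ> \<sigma> \<circ> inv x = \<sigma>'"
    using B_type_conjugate[OF \<sigma>] by blast
  have "inv x (x z) = z" for z
    using hyperoct_bij[OF x(1)] by (simp add: bij_is_inj)
  then have "inv x \<circ> (x \<circ> \<rho> \<circ> inv x) \<circ> x = \<rho>" for \<rho>
    by (simp add: fun_eq_iff)
  then have inj: "x \<circ> \<rho> \<circ> inv x = \<sigma>' \<longleftrightarrow> \<rho> = \<sigma>" for \<rho>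
    unfolding x(2)[symmetric] by metis
  have "Poly_Mapping.lookup y \<sigma>' = Poly_Mapping.lookup (conj_comb x y) \<sigma>'"
    using y x(1) by (simp add: Z_twisted_def)
  also have "\<dots> = (\<Sum>\<rho>\<in>Poly_Mapping.keys y. if \<rho> = \<sigma> then Poly_Mapping.lookup y \<rho> else 0)"
    unfolding conj_comb_def lookup_sum
    by (intro sum.cong refl) (simp add: lookup_single when_def inj)
  also have "\<dots> = Poly_Mapping.lookup y \<sigma>"
    by (simp add: in_keys_iff)
  finally show ?thesis ..
qed

lemma Z_twisted_eq_sum_class_sum:
  assumes y: "y \<in> Z_twisted n"
  shows "\<exists>c. y = (\<Sum>\<mu>\<in>partitions n. cscale (c \<mu>) (class_sum n \<mu>))"
proof -
  \<comment> \<open>If \<open>B_type n \<mu>\<close> is empty, this picks an arbitrary value, which multiplies a zero class sum.\<close>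
  define c where "c \<mu> = Poly_Mapping.lookup y (SOME \<sigma>. \<sigma> \<in> B_type n \<mu>)" for \<mu>
  have "y = (\<Sum>\<mu>\<in>partitions n. cscale (c \<mu>) (class_sum n \<mu>))"
  proof (rule poly_mapping_eqI)
    fix \<sigma>
    show "Poly_Mapping.lookup y \<sigma>
      = Poly_Mapping.lookup (\<Sum>\<mu>\<in>partitions n. cscale (c \<mu>) (class_sum n \<mu>)) \<sigma>"
    proof (cases "\<sigma> \<in> B_twisted n")
      case True
      then obtain \<mu> where \<mu>: "\<mu> \<in> partitions n" "\<sigma> \<in> B_type n \<mu>"
        by (auto simp: B_twisted_def)
      have "c \<mu> = Poly_Mapping.lookup y \<sigma>"
        unfolding c_def using Z_twisted_constant_on_B_type[OF y] someI[of "\<lambda>\<sigma>. \<sigma> \<in> B_type n \<mu>", OF \<mu>(2)] \<mu>(2)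
        by blast
      then show ?thesis by (simp add: lookup_sum_class_sum[OF \<mu>(2,1)])
    next
      case False
      then have "Poly_Mapping.lookup y \<sigma> = 0"
        using y by (auto simp: Z_twisted_def in_keys_iff)
      with False show ?thesis
        by (auto simp: lookup_sum lookup_class_sum B_twisted_def intro!: sum.neutral[symmetric])
    qed
  qed
  then show ?thesis by blast
qed

text \<open>The coefficients \<open>c \<mu>\<close> in the definition of \<open>Psi\<close> are not determined where \<open>B_type n \<mu>\<close> is
  empty, but the products \<open>c \<mu> \<cdot> card (B_type n \<mu>)\<close> are: they are the total coefficients of \<open>y\<close>
  on \<open>B_type n \<mu>\<close>.\<close>

lemma Psi_eq:
  assumes y: "y \<in> Z_twisted n"
  shows "Psi n y = (\<Sum>\<mu>\<in>partitions n. cscale (\<Sum>\<sigma>\<in>B_type n \<mu>. Poly_Mapping.lookup y \<sigma>) (p_part \<mu>))"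
proof -
  have total: "c \<mu> * of_nat (card (B_type n \<mu>)) = (\<Sum>\<sigma>\<in>B_type n \<mu>. Poly_Mapping.lookup y \<sigma>)"
    if "y = (\<Sum>\<mu>\<in>partitions n. cscale (c \<mu>) (class_sum n \<mu>))" "\<mu> \<in> partitions n" for c \<mu>
    unfolding that(1) using that(2) by (simp add: lookup_sum_class_sum)
  obtain c where c: "y = (\<Sum>\<mu>\<in>partitions n. cscale (c \<mu>) (class_sum n \<mu>))"
    using Z_twisted_eq_sum_class_sum[OF y] by blast
  show ?thesis
    unfolding Psi_def
  proof (rule the_equality)
    show "\<exists>c. y = (\<Sum>\<mu>\<in>partitions n. cscale (c \<mu>) (class_sum n \<mu>)) \<and>
      (\<Sum>\<mu>\<in>partitions n. cscale (\<Sum>\<sigma>\<in>B_type n \<mu>. Poly_Mapping.lookup y \<sigma>) (p_part \<mu>)) =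
      (\<Sum>\<mu>\<in>partitions n. cscale (c \<mu> * of_nat (card (B_type n \<mu>))) (p_part \<mu>))"
      using c total[OF c] by (intro exI[of _ c] conjI sum.cong) simp_all
  next
    fix f
    assume "\<exists>c. y = (\<Sum>\<mu>\<in>partitions n. cscale (c \<mu>) (class_sum n \<mu>)) \<and>
      f = (\<Sum>\<mu>\<in>partitions n. cscale (c \<mu> * of_nat (card (B_type n \<mu>))) (p_part \<mu>))"
    then obtain d where d: "y = (\<Sum>\<mu>\<in>partitions n. cscale (d \<mu>) (class_sum n \<mu>))"
      "f = (\<Sum>\<mu>\<in>partitions n. cscale (d \<mu> * of_nat (card (B_type n \<mu>))) (p_part \<mu>))"
      by blast
    show "f = (\<Sum>\<mu>\<in>partitions n. cscale (\<Sum>\<sigma>\<in>B_type n \<mu>. Poly_Mapping.lookup y \<sigma>) (p_part \<mu>))"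
      unfolding d(2) using total[OF d(1)] by (intro sum.cong) simp_all
  qed
qed

text \<open>The coefficient of \<open>p_part \<mu>\<close> in the image is the number of elements of \<open>B_type n \<mu>\<close> times the
  common coefficient on it, so an invariant combination can be recovered from its image.\<close>

lemma inj_on_Psi: "inj_on (Psi n) (Z_twisted n)"
proof (rule inj_onI, rule poly_mapping_eqI)
  fix y z \<sigma>
  assume y: "y \<in> Z_twisted n" and z: "z \<in> Z_twisted n" and eq: "Psi n y = Psi n z"
  show "Poly_Mapping.lookup y \<sigma> = Poly_Mapping.lookup z \<sigma>"
  proof (cases "\<sigma> \<in> B_twisted n")
    case True
    then obtain \<mu> where \<mu>: "\<mu> \<in> partitions n" "\<sigma> \<in> B_type n \<mu>"
      by (auto simp: B_twisted_def)
    have total: "Poly_Mapping.lookup (Psi n w) (exponents \<mu>)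
      = of_nat (card (B_type n \<mu>)) * Poly_Mapping.lookup w \<sigma>" if w: "w \<in> Z_twisted n" for w
    proof -
      have "Poly_Mapping.lookup (Psi n w) (exponents \<mu>) = (\<Sum>\<rho>\<in>B_type n \<mu>. Poly_Mapping.lookup w \<rho>)"
        unfolding Psi_eq[OF w] by (rule lookup_sum_p_part) (use \<mu>(1) in simp_all)
      also have "\<dots> = (\<Sum>\<rho>\<in>B_type n \<mu>. Poly_Mapping.lookup w \<sigma>)"
        using Z_twisted_constant_on_B_type[OF w _ \<mu>(2)] by (rule sum.cong[OF refl])
      finally show ?thesis by simp
    qed
    have "card (B_type n \<mu>) \<noteq> 0"
      using \<mu>(2) by (auto simp: card_eq_0_iff)
    with total[OF y] total[OF z] eq show ?thesis by simp
  next
    case False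
    then have "\<sigma> \<notin> Poly_Mapping.keys y" "\<sigma> \<notin> Poly_Mapping.keys z"
      using y z by (auto simp: Z_twisted_def)
    then show ?thesis by (simp add: in_keys_iff)
  qed
qed

section \<open>The cut-and-join recursion\<close>

text \<open>The constant \<open>a\<close> is the weight of every sequence; it carries the factor \<open>1 / (n! m!)\<close> of the
  generating function, so that no linearity of \<open>cut_join\<close> has to be established.\<close>

definition sequence_sum :: "nat \<Rightarrow> nat \<Rightarrow> complex \<Rightarrow> perm_comb" where
  "sequence_sum n m a = (\<Sum>ss\<in>admissible_sequences n m. Poly_Mapping.single (twisted_prod n ss) a)"

text \<open>Expanding \<open>cut_join_alg\<close> prepends every admissible transposition to every sequence. The weight
  stays the same.\<close>

lemma cut_join_alg_sequence_sum:
  "cut_join_alg n (sequence_sum n m a) = sequence_sum n (Suc m) a"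
proof -
  let ?I = "{(i, j). 1 \<le> i \<and> i < j \<and> j \<le> 2*n \<and> j \<noteq> tau n i}"
  let ?A = "admissible_transpositions n" and ?S = "admissible_sequences n m"
  have "cut_join_alg n (sequence_sum n m a) = (\<Sum>ss\<in>?S. \<Sum>(i, j)\<in>?I.
      Poly_Mapping.single (transpose i j \<circ> twisted_prod n ss \<circ> transpose (tau n i) (tau n j)) a)"
    unfolding cut_join_alg_def sequence_sum_def
    by (rule sum_keys_sum_single)
      (simp_all add: single_add sum.distrib case_prod_beta)
  also have "\<dots> = (\<Sum>ss\<in>?S. \<Sum>(i, j)\<in>?I.
      Poly_Mapping.single (twisted_prod n (transpose i j # ss)) a)"
    by (simp only: twisted_prod_Cons tau_conj_transpose)
  also have "\<dots> = (\<Sum>ss\<in>?S. \<Sum>s\<in>?A. Poly_Mapping.single (twisted_prod n (s # ss)) a)"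
    by (subst sum.reindex_bij_betw[OF bij_betw_transpositions, symmetric])
      (simp add: case_prod_beta)
  also have "\<dots> = (\<Sum>(ss, s)\<in>?S \<times> ?A. Poly_Mapping.single (twisted_prod n (s # ss)) a)"
    by (rule sum.cartesian_product)
  also have "\<dots> = sequence_sum n (Suc m) a"
    unfolding sequence_sum_def
  proof (rule sum.reindex_bij_witness[where i = "\<lambda>ss. (tl ss, hd ss)" and j = "\<lambda>(ss, s). s # ss"])
    fix ss assume ss: "ss \<in> admissible_sequences n (Suc m)"
    then obtain s ss' where "ss = s # ss'"
      by (cases ss) (simp_all add: admissible_sequences_def)
    with ss show "(tl ss, hd ss) \<in> ?S \<times> ?A" "(\<lambda>(ss, s). s # ss) (tl ss, hd ss) = ss"
      by (simp_all add: admissible_sequences_def)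
  qed (auto simp: admissible_sequences_def)
  finally show ?thesis .
qed

text \<open>Conjugation by an element of the hyperoctahedral group permutes the admissible sequences and
  conjugates their products.\<close>

lemma sequence_sum_in_Z_twisted: "sequence_sum n m a \<in> Z_twisted n"
proof -
  have "Poly_Mapping.keys (sequence_sum n m a)
      \<subseteq> (\<Union>ss\<in>admissible_sequences n m. Poly_Mapping.keys (Poly_Mapping.single (twisted_prod n ss) a))"
    unfolding sequence_sum_def by (rule Poly_Mapping.keys_sum)
  also have "\<dots> \<subseteq> B_twisted n"
    using twisted_prod_in_B_twisted by (auto split: if_splits)
  finally have keys: "Poly_Mapping.keys (sequence_sum n m a) \<subseteq> B_twisted n" .
  have "conj_comb x (sequence_sum n m a) = sequence_sum n m a" if x: "x \<in> hyperoct n" for x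
  proof -
    have "conj_comb x (sequence_sum n m a)
        = (\<Sum>ss\<in>admissible_sequences n m. Poly_Mapping.single (x \<circ> twisted_prod n ss \<circ> inv x) a)"
      unfolding conj_comb_def sequence_sum_def
      by (rule sum_keys_sum_single) (simp_all add: single_add)
    also have "\<dots> = (\<Sum>ss\<in>admissible_sequences n m.
        Poly_Mapping.single (twisted_prod n (map (\<lambda>s. x \<circ> s \<circ> inv x) ss)) a)"
      by (simp only: twisted_prod_conj[OF x])
    also have "\<dots> = sequence_sum n m a"
      unfolding sequence_sum_def
      by (rule sum.reindex_bij_betw[OF bij_betw_conj_sequences[OF x]])
    finally show ?thesis .
  qed
  with keys show ?thesis by (simp add: Z_twisted_def)
qed

text \<open>A sequence contributes its weight to the coefficient of \<open>p_part \<mu>\<close> exactly when its product has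
  type \<open>\<mu>\<close>, which is the definition of a Hurwitz sequence.\<close>

lemma Psi_sequence_sum:
  "Psi n (sequence_sum n m a)
    = (\<Sum>\<mu>\<in>partitions n. cscale (of_nat (card (hurwitz_sequences m \<mu>)) * a) (p_part \<mu>))"
  unfolding Psi_eq[OF sequence_sum_in_Z_twisted]
proof (rule sum.cong[OF refl])
  fix \<mu> assume "\<mu> \<in> partitions n"
  then have H: "hurwitz_sequences m \<mu> = {ss \<in> admissible_sequences n m. twisted_prod n ss \<in> B_type n \<mu>}"
    by (auto simp: hurwitz_sequences_def admissible_sequences_def twisted_prod_def partitions_def Let_def)
  have "(\<Sum>\<sigma>\<in>B_type n \<mu>. Poly_Mapping.lookup (sequence_sum n m a) \<sigma>)
      = (\<Sum>ss\<in>admissible_sequences n m. \<Sum>\<sigma>\<in>B_type n \<mu>. if twisted_prod n ss = \<sigma> then a else 0)"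
    unfolding sequence_sum_def lookup_sum lookup_single when_def by (rule sum.swap)
  also have "\<dots> = (\<Sum>ss\<in>admissible_sequences n m. if twisted_prod n ss \<in> B_type n \<mu> then a else 0)"
    by simp
  also have "\<dots> = of_nat (card (hurwitz_sequences m \<mu>)) * a"
    by (simp add: H sum.If_cases Int_def)
  finally show "cscale (\<Sum>\<sigma>\<in>B_type n \<mu>. Poly_Mapping.lookup (sequence_sum n m a) \<sigma>) (p_part \<mu>)
      = cscale (of_nat (card (hurwitz_sequences m \<mu>)) * a) (p_part \<mu>)"
    by simp
qed

text \<open>Injectivity is what makes the preimage chosen inside \<open>cut_join\<close> the intended one.\<close>

lemma cut_join_Psi:
  "y \<in> Z_twisted n \<Longrightarrow> cut_join n (Psi n y) = Psi n (cut_join_alg n y)"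
  by (simp add: cut_join_def inv_into_f_f[OF inj_on_Psi])

lemma twisted_hurwitz_series_nth:
  "fps_nth (twisted_hurwitz_series n) m = Psi n (sequence_sum n m (1 / (fact n * fact m)))"
  unfolding Psi_sequence_sum twisted_hurwitz_series_def fps_nth_Abs_fps
  by (intro sum.cong) (simp_all add: twisted_hurwitz_def partitions_def)

lemma of_nat_mult_cscale:
  "of_nat k * (\<Sum>\<mu>\<in>M. cscale (c \<mu>) (p_part \<mu>)) = (\<Sum>\<mu>\<in>M. cscale (of_nat k * c \<mu>) (p_part \<mu>))"
proof (induction k)
  case 0
  show ?case
    by (rule poly_mapping_eqI) (simp add: lookup_sum)
next
  case (Suc k)
  show ?case
    unfolding of_nat_Suc distrib_right Suc.IH mult_1 sum.distrib[symmetric]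
    by (intro sum.cong poly_mapping_eqI) (simp_all add: lookup_add distrib_right)
qed

theorem theorem2p10:
  shows "series_deriv_beta twisted_hurwitz_series = series_cut_join twisted_hurwitz_series"
proof (rule ext, rule fps_ext)
  fix n m
  let ?a = "1 / (fact n * fact m) :: complex"
  have "fps_nth (series_deriv_beta twisted_hurwitz_series n) m
      = of_nat (Suc m) * Psi n (sequence_sum n (Suc m) (1 / (fact n * fact (Suc m))))"
    by (simp add: series_deriv_beta_def twisted_hurwitz_series_nth)
  also have "\<dots> = Psi n (sequence_sum n (Suc m) ?a)"
    unfolding Psi_sequence_sum of_nat_mult_cscale
    by (intro sum.cong arg_cong2[of _ _ _ _ cscale] refl) (simp add: divide_simps del: of_nat_Suc)
  also have "\<dots> = cut_join n (Psi n (sequence_sum n m ?a))"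
    by (simp only: cut_join_Psi[OF sequence_sum_in_Z_twisted] cut_join_alg_sequence_sum)
  also have "\<dots> = fps_nth (series_cut_join twisted_hurwitz_series n) m"
    by (simp add: series_cut_join_def twisted_hurwitz_series_nth)
  finally show "fps_nth (series_deriv_beta twisted_hurwitz_series n) m
      = fps_nth (series_cut_join twisted_hurwitz_series n) m" .
qed

end
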